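(* Assume the domain is periodic. Consider one forward Euler step of size $\tau>0$ of the low order scheme, which on each element reads $$\mathbf{M}\frac{\mathbf{u}^{{\rm L},n+1}-\mathbf{u}^n}{\tau}+\sum_{k=1}^2\left(\left(\mathbf{Q}_k^{\rm L}-(\mathbf{Q}_k^{\rm L})^T\right)\circ\mathbf{F}_k\right)\mathbf{1}-(\boldsymbol{\Lambda}\circ\mathbf{D})\mathbf{1}+\sum_{k=1}^2\mathbf{E}^T\left[\mathbf{B}_k\mathbf{f}_k^*-\boldsymbol{\lambda}_k[\![\mathbf{u}]\!]\right]=0,$$ with all spatial terms evaluated at the nodal states $\mathbf{u}^n$ (assumed such that the fluxes and coefficients are defined) and viscous fluxes $\boldsymbol{\sigma}$. (i) The scheme is conservative: summing over all elements, $$\mathbf{1}^T\mathbf{M}\mathbf{u}^{{\rm L},n+1}=\mathbf{1}^T\mathbf{M}\mathbf{u}^{n}$$ for each of the four components of the state. (ii) If $\mathbf{u}^n_i\in\mathcal{A}$ for all nodes $i$ (of all elements), and the time step condition $$\tau\le\frac{m_i}{2\lambda_i},\qquad \lambda_i=\sum_{j\in\mathcal{I}(i)}\lambda_{ij}+\sum_{j\in\mathcal{B}(i)}\sum_{k=1}^2(\boldsymbol{\lambda}_k)_j,$$ holds for all nodes $i$, then $\mathbf{u}^{{\rm L},n+1}_i\in\mathcal{A}$ for all nodes $i$.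
   Context: Setting: two-dimensional compressible Euler/Navier-Stokes equations with ideal gas law, $\gamma>1$. States and fluxes: a state is $\mathbf{u}=(\rho,\rho u_1,\rho u_2,E)\in\mathbb{R}^4$ with density $\rho$, velocity $(u_1,u_2)$, total energy $E$; $\rho e=E-\frac12\rho(u_1^2+u_2^2)$; $p=(\gamma-1)\rho e$. The admissible set is $\mathcal{A}=\{\mathbf{u}:\rho>0,\ \rho e>0\}$. The inviscid fluxes are $$\mathbf{f}_1(\mathbf{u})=(\rho u_1,\rho u_1^2+p,\rho u_1u_2,(E+p)u_1),\qquad \mathbf{f}_2(\mathbf{u})=(\rho u_2,\rho u_1u_2,\rho u_2^2+p,(E+p)u_2).$$ At each node $i$ of each element there is a given viscous flux $\boldsymbol{\sigma}_i=((\boldsymbol{\sigma}_1)_i,(\boldsymbol{\sigma}_2)_i)$, $(\boldsymbol{\sigma}_k)_i\in\mathbb{R}^4$, having the structure of a compressible Navier-Stokes viscous flux: the first component of each $(\boldsymbol{\sigma}_k)_i$ is zero, and the stress is symmetric (third component of $(\boldsymbol{\sigma}_1)_i$ equals second component of $(\boldsymbol{\sigma}_2)_i$). $\boldsymbol{\sigma}=0$ gives the Euler equations. Discrete operators: on each element (geometric factors absorbed, superscripts for the element suppressed) there are $N_p$ volume nodes and $N_p^f$ face quadrature points, each face point coinciding with a volume node (a volume node, e.g. a corner, may coincide with several face points). - $\mathbf{M}=\mathrm{diag}(m_i)$ with $m_i>0$. - $\mathbf{E}\in\{0,1\}^{N_p^f\times N_p}$ extracts face-point values from nodal values: row $j$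 has a single $1$, in the column of the volume node coinciding with face point $j$. - $\mathbf{B}_k=\mathrm{diag}(w^f_j\,\widehat n_{k,j})$, $k=1,2$, with weights $w_j^f>0$ and unit outward normals $\widehat{\mathbf{n}}_j=(\widehat n_{1,j},\widehat n_{2,j})$. - $\mathbf{Q}_k^{\rm L}\in\mathbb{R}^{N_p\times N_p}$, $k=1,2$, are (sparse low order) operators satisfying $\mathbf{Q}_k^{\rm L}+(\mathbf{Q}_k^{\rm L})^T=\mathbf{E}^T\mathbf{B}_k\mathbf{E}$ and $\mathbf{Q}_k^{\rm L}\mathbf{1}=0$. Matrices act componentwise on vectors of states, $\circ$ is the Hadamard product (a scalar matrix times a matrix of $\mathbb{R}^4$-valued entries), and $\mathbf{1}$ is the vector of ones. Periodicity and neighbors: every face point of an element is matched with exactly one face point of a neighboring element (a pairing over the whole periodic mesh), with the same weight and opposite normal, so $\mathbf{B}_k^+=-\mathbf{B}_k$. The superscript $+$ denotes the value at the matched face point (e.g. $\mathbf{u}^+$, $\boldsymbol{\sigma}^+$); the jump is $[\![\mathbf{u}]\!]=\mathbf{u}^+-\mathbf{u}$ at face points. Terms of the scheme: $$(\mathbf{F}_k)_{ij}=\tfrac12\left(\mathbf{f}_k(\mathbf{u}_i)+\mathbf{f}_k(\mathbf{u}_j)-(\boldsymbol{\sigma}_k)_i-(\boldsymbol{\sigma}_k)_j\right),\qquad \mathbf{D}_{ij}=\mathbf{u}_j-\mathbf{u}_i,\qquad \boldsymbol{\Lambda}_{ij}=\lambda_{ij},$$ and at each face point $$\mathbf{f}_k^*=\tfrac12\left(\mathbf{f}_k(\mathbf{u})+\mathbf{f}_k(\mathbf{u}^+)-\boldsymbol{\sigma}_k-\boldsymbol{\sigma}_k^+\right).$$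 Graph viscosity coefficients: set $\mathbf{n}_{ij}=\frac12\left((\mathbf{Q}_1^{\rm L}-(\mathbf{Q}_1^{\rm L})^T)_{ij},\,(\mathbf{Q}_2^{\rm L}-(\mathbf{Q}_2^{\rm L})^T)_{ij}\right)\in\mathbb{R}^2$. Then $$\lambda_{ij}=\max\left\{\beta\left(\mathbf{u}_i,\boldsymbol{\sigma}_i,\tfrac{\mathbf{n}_{ij}}{\|\mathbf{n}_{ij}\|}\right),\beta\left(\mathbf{u}_j,\boldsymbol{\sigma}_j,\tfrac{\mathbf{n}_{ij}}{\|\mathbf{n}_{ij}\|}\right)\right\}\|\mathbf{n}_{ij}\|$$ if $\mathbf{n}_{ij}\ne0$ and $\lambda_{ij}=0$ if $\mathbf{n}_{ij}=0$. $\boldsymbol{\lambda}_k$ is diagonal over face points, with entry at face point $j$ (located at volume node $i$) $$(\boldsymbol{\lambda}_k)_j=\frac{|(\mathbf{B}_k)_{jj}|}{2}\max\left\{\beta(\mathbf{u}_i,\boldsymbol{\sigma}_i,\widehat{\mathbf{n}}_j),\ \beta(\mathbf{u}_j^+,\boldsymbol{\sigma}_j^+,\widehat{\mathbf{n}}_j)\right\}.$$ Here, for a unit vector $\mathbf{n}=(n_1,n_2)$, $$\beta(\mathbf{u},\boldsymbol{\sigma},\mathbf{n})=\epsilon_0+|n_1u_1+n_2u_2|+\frac{1}{2\rho^2e}\left(\sqrt{\rho^2(\mathbf{q}\cdot\mathbf{n})^2+2\rho^2e\,\|\mathbf{n}\cdot\boldsymbol{\tau}-p\,\mathbf{n}\|^2}+\rho|\mathbf{q}\cdot\mathbf{n}|\right),$$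 with $\epsilon_0>0$ a fixed (arbitrarily small) number, $\|\cdot\|$ the Euclidean norm, and (writing $(\boldsymbol{\sigma}_k)_c$ for the $c$-th component) $$\mathbf{n}\cdot\boldsymbol{\tau}=\begin{pmatrix}n_1(\boldsymbol{\sigma}_1)_2+n_2(\boldsymbol{\sigma}_1)_3\\ n_1(\boldsymbol{\sigma}_2)_2+n_2(\boldsymbol{\sigma}_2)_3\end{pmatrix},\qquad \mathbf{q}=\begin{pmatrix}u_1(\boldsymbol{\sigma}_1)_2+u_2(\boldsymbol{\sigma}_1)_3-(\boldsymbol{\sigma}_1)_4\\ u_1(\boldsymbol{\sigma}_2)_2+u_2(\boldsymbol{\sigma}_2)_3-(\boldsymbol{\sigma}_2)_4\end{pmatrix}.$$ Index sets: for a volume node $i$ of an element, $\mathcal{I}(i)$ is the set of volume nodes $j$ of the same element with $\mathbf{n}_{ij}\neq0$, and $\mathcal{B}(i)$ is the set of exterior neighbors of node $i$, indexed by the face points $j$ of the element located at node $i$ (empty if $i$ is an interior node). The condition $\tau\le m_i/(2\lambda_i)$ is understood as $2\tau\lambda_i\le m_i$. *)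

theory Defs
  imports "HOL-Analysis.Analysis" "Jordan_Normal_Form.Matrix"
begin

(* \<open>$\<close> is used below only for components of vectors in real^n; matrices whose size
   varies from element to element are Jordan_Normal_Form matrices, indexed by \<open>$$\<close>. *)
no_notation Matrix.vec_index (infixl "$" 100)

section \<open>States, fluxes and the wave speed bound\<close>

(* A state is (rho, rho u_1, rho u_2, E). *)
type_synonym state = "real^4"

(* sigma $ k is the flux sigma_k, k = 1, 2. *)
type_synonym viscous_flux = "real^4^2"

definition density :: "state \<Rightarrow> real" where
  "density u = u $ 1"

definition velocity :: "state \<Rightarrow> real^2" where
  "velocity u = vector [u $ 2 / u $ 1, u $ 3 / u $ 1]"

definition internal_energy_density :: "state \<Rightarrow> real" where
  "internal_energy_density u =
     u $ 4 - 1/2 * density u * ((velocity u $ 1)^2 + (velocity u $ 2)^2)"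

definition specific_internal_energy :: "state \<Rightarrow> real" where
  "specific_internal_energy u = internal_energy_density u / density u"

definition pressure :: "real \<Rightarrow> state \<Rightarrow> real" where
  "pressure \<gamma> u = (\<gamma> - 1) * internal_energy_density u"

definition admissible :: "state set" where
  "admissible = {u. density u > 0 \<and> internal_energy_density u > 0}"

definition inviscid_flux :: "real \<Rightarrow> state \<Rightarrow> real^4^2" where
  "inviscid_flux \<gamma> u =
     (let \<rho> = density u; u1 = velocity u $ 1; u2 = velocity u $ 2; p = pressure \<gamma> u; En = u $ 4 in
      vector [vector [\<rho> * u1, \<rho> * u1^2 + p, \<rho> * u1 * u2, (En + p) * u1],
              vector [\<rho> * u2, \<rho> * u1 * u2, \<rho> * u2^2 + p, (En + p) * u2]])"

definition viscous_structure :: "viscous_flux \<Rightarrow> bool" where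
  "viscous_structure \<sigma> \<longleftrightarrow> (\<forall>k. \<sigma> $ k $ 1 = 0) \<and> \<sigma> $ 1 $ 3 = \<sigma> $ 2 $ 2"

definition normal_stress :: "viscous_flux \<Rightarrow> real^2 \<Rightarrow> real^2" where
  "normal_stress \<sigma> n =
     vector [n $ 1 * \<sigma> $ 1 $ 2 + n $ 2 * \<sigma> $ 1 $ 3,
             n $ 1 * \<sigma> $ 2 $ 2 + n $ 2 * \<sigma> $ 2 $ 3]"

definition heat_flux :: "state \<Rightarrow> viscous_flux \<Rightarrow> real^2" where
  "heat_flux u \<sigma> =
     (let u1 = velocity u $ 1; u2 = velocity u $ 2 in
      vector [u1 * \<sigma> $ 1 $ 2 + u2 * \<sigma> $ 1 $ 3 - \<sigma> $ 1 $ 4,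
              u1 * \<sigma> $ 2 $ 2 + u2 * \<sigma> $ 2 $ 3 - \<sigma> $ 2 $ 4])"

definition beta_radicand :: "real \<Rightarrow> state \<Rightarrow> viscous_flux \<Rightarrow> real^2 \<Rightarrow> real" where
  "beta_radicand \<gamma> u \<sigma> n =
     (density u)^2 * (heat_flux u \<sigma> \<bullet> n)^2 +
     2 * (density u)^2 * specific_internal_energy u *
       (norm (normal_stress \<sigma> n - pressure \<gamma> u *\<^sub>R n))^2"

definition beta :: "real \<Rightarrow> real \<Rightarrow> state \<Rightarrow> viscous_flux \<Rightarrow> real^2 \<Rightarrow> real" where
  "beta \<gamma> \<epsilon>\<^sub>0 u \<sigma> n =
     \<epsilon>\<^sub>0 + \<bar>n \<bullet> velocity u\<bar> +
     1 / (2 * (density u)^2 * specific_internal_energy u) *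
       (sqrt (beta_radicand \<gamma> u \<sigma> n) + density u * \<bar>heat_flux u \<sigma> \<bullet> n\<bar>)"

(* Division and sqrt are total in HOL; this says that no division by zero and no root of a
   negative number occurs in beta. *)
definition beta_defined :: "real \<Rightarrow> state \<Rightarrow> viscous_flux \<Rightarrow> real^2 \<Rightarrow> bool" where
  "beta_defined \<gamma> u \<sigma> n \<longleftrightarrow>
     density u \<noteq> 0 \<and> specific_internal_energy u \<noteq> 0 \<and> beta_radicand \<gamma> u \<sigma> n \<ge> 0"


section \<open>Periodic meshes with low order summation-by-parts operators\<close>

(* 'e is the (finite) set of elements. On the element e the volume nodes are the i < nvol e,
   the face points the j < nface e; fnode e j is the volume node with which the face point j
   coincides, and nbr pairs the face points (e, j) of the whole mesh.
   Geometric factors are absorbed in the operators. *)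
record 'e dg_mesh =
  nvol :: "'e \<Rightarrow> nat"
  nface :: "'e \<Rightarrow> nat"
  mass :: "'e \<Rightarrow> nat \<Rightarrow> real"
  fnode :: "'e \<Rightarrow> nat \<Rightarrow> nat"
  fweight :: "'e \<Rightarrow> nat \<Rightarrow> real"
  fnormal :: "'e \<Rightarrow> nat \<Rightarrow> real^2"
  QL :: "'e \<Rightarrow> 2 \<Rightarrow> real mat"
  nbr :: "'e \<times> nat \<Rightarrow> 'e \<times> nat"

definition M_mat :: "'e dg_mesh \<Rightarrow> 'e \<Rightarrow> real mat" where
  "M_mat D e = mat_diag (nvol D e) (mass D e)"

definition E_mat :: "'e dg_mesh \<Rightarrow> 'e \<Rightarrow> real mat" where
  "E_mat D e = Matrix.mat (nface D e) (nvol D e) (\<lambda>(j, i). if fnode D e j = i then 1 else 0)"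

definition B_mat :: "'e dg_mesh \<Rightarrow> 'e \<Rightarrow> 2 \<Rightarrow> real mat" where
  "B_mat D e k = mat_diag (nface D e) (\<lambda>j. fweight D e j * fnormal D e j $ k)"

definition skew_Q :: "'e dg_mesh \<Rightarrow> 'e \<Rightarrow> 2 \<Rightarrow> real mat" where
  "skew_Q D e k = QL D e k - transpose_mat (QL D e k)"

definition sbp_element :: "'e dg_mesh \<Rightarrow> 'e \<Rightarrow> bool" where
  "sbp_element D e \<longleftrightarrow>
     (\<forall>i < nvol D e. mass D e i > 0) \<and>
     (\<forall>j < nface D e. fnode D e j < nvol D e \<and> fweight D e j > 0 \<and> norm (fnormal D e j) = 1) \<and>
     (\<forall>k. QL D e k \<in> carrier_mat (nvol D e) (nvol D e) \<and>
          QL D e k + transpose_mat (QL D e k) = transpose_mat (E_mat D e) * B_mat D e k * E_mat D e \<and>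
          QL D e k *\<^sub>v Matrix.vec (nvol D e) (\<lambda>_. 1) = 0\<^sub>v (nvol D e))"

definition face_points :: "'e dg_mesh \<Rightarrow> ('e \<times> nat) set" where
  "face_points D = {(e, j). j < nface D e}"

definition periodic_pairing :: "'e dg_mesh \<Rightarrow> bool" where
  "periodic_pairing D \<longleftrightarrow>
     (\<forall>x \<in> face_points D. nbr D x \<in> face_points D \<and> nbr D (nbr D x) = x \<and>
        fweight D (fst (nbr D x)) (snd (nbr D x)) = fweight D (fst x) (snd x) \<and>
        fnormal D (fst (nbr D x)) (snd (nbr D x)) = - fnormal D (fst x) (snd x))"

definition periodic_mesh :: "'e dg_mesh \<Rightarrow> bool" where
  "periodic_mesh D \<longleftrightarrow> (\<forall>e. sbp_element D e) \<and> periodic_pairing D"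


section \<open>The low order scheme\<close>

(* Nodal values: v e i for the volume node i of the element e. *)

definition mat_apply :: "real mat \<Rightarrow> (nat \<Rightarrow> state) \<Rightarrow> nat \<Rightarrow> state" where
  "mat_apply A v i = (\<Sum>j < dim_col A. A $$ (i, j) *\<^sub>R v j)"

(* (A o G) 1, where G is a matrix of states. *)
definition hadamard_one :: "real mat \<Rightarrow> (nat \<Rightarrow> nat \<Rightarrow> state) \<Rightarrow> nat \<Rightarrow> state" where
  "hadamard_one A G i = (\<Sum>j < dim_col A. A $$ (i, j) *\<^sub>R G i j)"

definition face_value :: "'e dg_mesh \<Rightarrow> ('e \<Rightarrow> nat \<Rightarrow> 'b) \<Rightarrow> 'e \<Rightarrow> nat \<Rightarrow> 'b" where
  "face_value D v e j = v e (fnode D e j)"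

definition face_value_plus :: "'e dg_mesh \<Rightarrow> ('e \<Rightarrow> nat \<Rightarrow> 'b) \<Rightarrow> 'e \<Rightarrow> nat \<Rightarrow> 'b" where
  "face_value_plus D v e j = (case nbr D (e, j) of (e', j') \<Rightarrow> face_value D v e' j')"

definition volume_flux ::
  "real \<Rightarrow> ('e \<Rightarrow> nat \<Rightarrow> state) \<Rightarrow> ('e \<Rightarrow> nat \<Rightarrow> viscous_flux) \<Rightarrow> 'e \<Rightarrow> 2 \<Rightarrow> nat \<Rightarrow> nat \<Rightarrow> state" where
  "volume_flux \<gamma> u \<sigma> e k i j =
     (1/2) *\<^sub>R (inviscid_flux \<gamma> (u e i) $ k + inviscid_flux \<gamma> (u e j) $ k - \<sigma> e i $ k - \<sigma> e j $ k)"

definition interface_flux ::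
  "'e dg_mesh \<Rightarrow> real \<Rightarrow> ('e \<Rightarrow> nat \<Rightarrow> state) \<Rightarrow> ('e \<Rightarrow> nat \<Rightarrow> viscous_flux) \<Rightarrow> 'e \<Rightarrow> 2 \<Rightarrow> nat \<Rightarrow> state" where
  "interface_flux D \<gamma> u \<sigma> e k j =
     (1/2) *\<^sub>R (inviscid_flux \<gamma> (face_value D u e j) $ k + inviscid_flux \<gamma> (face_value_plus D u e j) $ k
              - face_value D \<sigma> e j $ k - face_value_plus D \<sigma> e j $ k)"

definition jump :: "'e dg_mesh \<Rightarrow> ('e \<Rightarrow> nat \<Rightarrow> state) \<Rightarrow> 'e \<Rightarrow> nat \<Rightarrow> state" where
  "jump D u e j = face_value_plus D u e j - face_value D u e j"

definition graph_normal :: "'e dg_mesh \<Rightarrow> 'e \<Rightarrow> nat \<Rightarrow> nat \<Rightarrow> real^2" where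
  "graph_normal D e i j = (1/2) *\<^sub>R (\<chi> k. skew_Q D e k $$ (i, j))"

definition graph_viscosity ::
  "'e dg_mesh \<Rightarrow> real \<Rightarrow> real \<Rightarrow> ('e \<Rightarrow> nat \<Rightarrow> state) \<Rightarrow> ('e \<Rightarrow> nat \<Rightarrow> viscous_flux) \<Rightarrow>
     'e \<Rightarrow> nat \<Rightarrow> nat \<Rightarrow> real" where
  "graph_viscosity D \<gamma> \<epsilon>\<^sub>0 u \<sigma> e i j =
     (let n = graph_normal D e i j in
      if n = 0 then 0
      else max (beta \<gamma> \<epsilon>\<^sub>0 (u e i) (\<sigma> e i) (n /\<^sub>R norm n))
               (beta \<gamma> \<epsilon>\<^sub>0 (u e j) (\<sigma> e j) (n /\<^sub>R norm n)) * norm n)"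

definition Lambda_mat ::
  "'e dg_mesh \<Rightarrow> real \<Rightarrow> real \<Rightarrow> ('e \<Rightarrow> nat \<Rightarrow> state) \<Rightarrow> ('e \<Rightarrow> nat \<Rightarrow> viscous_flux) \<Rightarrow> 'e \<Rightarrow> real mat" where
  "Lambda_mat D \<gamma> \<epsilon>\<^sub>0 u \<sigma> e =
     Matrix.mat (nvol D e) (nvol D e) (\<lambda>(i, j). graph_viscosity D \<gamma> \<epsilon>\<^sub>0 u \<sigma> e i j)"

definition face_viscosity ::
  "'e dg_mesh \<Rightarrow> real \<Rightarrow> real \<Rightarrow> ('e \<Rightarrow> nat \<Rightarrow> state) \<Rightarrow> ('e \<Rightarrow> nat \<Rightarrow> viscous_flux) \<Rightarrow>
     'e \<Rightarrow> 2 \<Rightarrow> nat \<Rightarrow> real" where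
  "face_viscosity D \<gamma> \<epsilon>\<^sub>0 u \<sigma> e k j =
     \<bar>B_mat D e k $$ (j, j)\<bar> / 2 *
       max (beta \<gamma> \<epsilon>\<^sub>0 (face_value D u e j) (face_value D \<sigma> e j) (fnormal D e j))
           (beta \<gamma> \<epsilon>\<^sub>0 (face_value_plus D u e j) (face_value_plus D \<sigma> e j) (fnormal D e j))"

definition lambda_mat ::
  "'e dg_mesh \<Rightarrow> real \<Rightarrow> real \<Rightarrow> ('e \<Rightarrow> nat \<Rightarrow> state) \<Rightarrow> ('e \<Rightarrow> nat \<Rightarrow> viscous_flux) \<Rightarrow>
     'e \<Rightarrow> 2 \<Rightarrow> real mat" where
  "lambda_mat D \<gamma> \<epsilon>\<^sub>0 u \<sigma> e k = mat_diag (nface D e) (face_viscosity D \<gamma> \<epsilon>\<^sub>0 u \<sigma> e k)"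

definition spatial_terms_defined ::
  "'e dg_mesh \<Rightarrow> real \<Rightarrow> ('e \<Rightarrow> nat \<Rightarrow> state) \<Rightarrow> ('e \<Rightarrow> nat \<Rightarrow> viscous_flux) \<Rightarrow> bool" where
  "spatial_terms_defined D \<gamma> u \<sigma> \<longleftrightarrow>
     (\<forall>e. \<forall>i < nvol D e. density (u e i) \<noteq> 0) \<and>
     (\<forall>e. \<forall>i < nvol D e. \<forall>j < nvol D e. \<forall>n. n = graph_normal D e i j \<and> n \<noteq> 0 \<longrightarrow>
        beta_defined \<gamma> (u e i) (\<sigma> e i) (n /\<^sub>R norm n) \<and>
        beta_defined \<gamma> (u e j) (\<sigma> e j) (n /\<^sub>R norm n)) \<and>
     (\<forall>e. \<forall>j < nface D e.
        beta_defined \<gamma> (face_value D u e j) (face_value D \<sigma> e j) (fnormal D e j) \<and>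
        beta_defined \<gamma> (face_value_plus D u e j) (face_value_plus D \<sigma> e j) (fnormal D e j))"

definition low_order_step ::
  "'e dg_mesh \<Rightarrow> real \<Rightarrow> real \<Rightarrow> real \<Rightarrow> ('e \<Rightarrow> nat \<Rightarrow> viscous_flux) \<Rightarrow>
     ('e \<Rightarrow> nat \<Rightarrow> state) \<Rightarrow> ('e \<Rightarrow> nat \<Rightarrow> state) \<Rightarrow> bool" where
  "low_order_step D \<gamma> \<epsilon>\<^sub>0 \<tau> \<sigma> u u' \<longleftrightarrow>
     (\<forall>e. \<forall>i < nvol D e.
        mat_apply (M_mat D e) (\<lambda>i. (u' e i - u e i) /\<^sub>R \<tau>) i
        + (\<Sum>k\<in>UNIV. hadamard_one (skew_Q D e k) (volume_flux \<gamma> u \<sigma> e k) i)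
        - hadamard_one (Lambda_mat D \<gamma> \<epsilon>\<^sub>0 u \<sigma> e) (\<lambda>i j. u e j - u e i) i
        + (\<Sum>k\<in>UNIV. mat_apply (transpose_mat (E_mat D e))
             (\<lambda>j. mat_apply (B_mat D e k) (interface_flux D \<gamma> u \<sigma> e k) j
                - mat_apply (lambda_mat D \<gamma> \<epsilon>\<^sub>0 u \<sigma> e k) (jump D u e) j) i)
        = 0)"

definition volume_neighbors :: "'e dg_mesh \<Rightarrow> 'e \<Rightarrow> nat \<Rightarrow> nat set" where
  "volume_neighbors D e i = {j. j < nvol D e \<and> graph_normal D e i j \<noteq> 0}"

(* Exterior neighbours, indexed by the face points located at the node i. *)
definition exterior_neighbors :: "'e dg_mesh \<Rightarrow> 'e \<Rightarrow> nat \<Rightarrow> nat set" where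
  "exterior_neighbors D e i = {j. j < nface D e \<and> fnode D e j = i}"

definition node_viscosity ::
  "'e dg_mesh \<Rightarrow> real \<Rightarrow> real \<Rightarrow> ('e \<Rightarrow> nat \<Rightarrow> state) \<Rightarrow> ('e \<Rightarrow> nat \<Rightarrow> viscous_flux) \<Rightarrow>
     'e \<Rightarrow> nat \<Rightarrow> real" where
  "node_viscosity D \<gamma> \<epsilon>\<^sub>0 u \<sigma> e i =
     (\<Sum>j\<in>volume_neighbors D e i. graph_viscosity D \<gamma> \<epsilon>\<^sub>0 u \<sigma> e i j)
     + (\<Sum>j\<in>exterior_neighbors D e i. \<Sum>k\<in>UNIV. face_viscosity D \<gamma> \<epsilon>\<^sub>0 u \<sigma> e k j)"

(* 1^T M u, summed over all elements. *)
definition total_mass :: "('e::finite) dg_mesh \<Rightarrow> ('e \<Rightarrow> nat \<Rightarrow> state) \<Rightarrow> state" where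
  "total_mass D u = (\<Sum>e\<in>UNIV. \<Sum>i < nvol D e. mat_apply (M_mat D e) (u e) i)"

end

theory Submission
  imports Defs
begin

text \<open>
  Write \<open>F(u, \<sigma>) \<cdot> n\<close> for the sum over \<open>k\<close> of \<open>n\<^sub>k (f\<^sub>k(u) - \<sigma>\<^sub>k)\<close>. Conservation holds because the scheme
  only exchanges quantities: between the volume nodes \<open>i\<close> and \<open>j\<close> of an element the exchanged amount is
  antisymmetric in \<open>i\<close> and \<open>j\<close>, since the vectors \<open>n\<^sub>i\<^sub>j\<close> are skew while \<open>F\<^sub>i\<^sub>j\<close> and \<open>\<lambda>\<^sub>i\<^sub>j\<close> are symmetric; across a
  face it changes sign under the pairing of face points, since the normal does and the weights and
  viscosities do not. Both sums therefore cancel (lemma \<open>low_order_step_conservative\<close>).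

  Admissibility rests on two facts. First, the admissible set is a convex cone, being an intersection of
  half-spaces: the internal energy is the minimum over all frame velocities \<open>w\<close> of the energy seen in the
  frame moving with \<open>w\<close>, and that energy is linear in the state. Second, \<open>\<beta>\<close> is a wave speed
  bound: \<open>s u - F(u, \<sigma>) \<cdot> n\<close> is admissible as soon as \<open>s \<ge> \<beta>(u, \<sigma>, n)\<close>. Its internal energy is
  a quadratic polynomial in \<open>s - n \<cdot> velocity\<close>, divided by that number, and the last
  summand of \<open>\<beta>\<close> bounds the roots of this polynomial (lemma \<open>admissible_scaleR_minus_normal_flux\<close>).

  The two are connected by summation by parts. The vectors \<open>n\<^sub>i\<^sub>j\<close> with fixed \<open>i\<close> add up to minus half the
  weighted normals of the faces at \<open>i\<close> (lemma \<open>sum_graph_normal\<close>), so that all flux terms at the node's own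
  state cancel. Hence \<open>m\<^sub>i\<close> times the new state is
  \<open>(m\<^sub>i - \<tau> \<lambda>\<^sub>i) u\<^sub>i\<close> plus \<open>\<tau>\<close> times a sum of terms \<open>\<lambda> u - F(u, \<sigma>) \<cdot> n\<close> taken at the
  neighbors (lemma \<open>low_order_step_cone_combination\<close>). Each of them is admissible by the choice of the
  viscosities, and \<open>m\<^sub>i - \<tau> \<lambda>\<^sub>i > 0\<close> by the time step condition.
\<close>

(* The matrix library uses the same symbol for the scalar product of its vectors. *)
no_notation Matrix.scalar_prod (infix "\<bullet>" 70)

section \<open>The admissible set is a convex cone\<close>

text \<open>
  The total energy of \<open>u\<close> observed in the frame that moves with velocity \<open>w\<close>.
\<close>

definition relative_energy :: "real^2 \<Rightarrow> state \<Rightarrow> real" where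
  "relative_energy w u =
     u $ 4 - (w $ 1 * u $ 2 + w $ 2 * u $ 3) + 1/2 * ((w $ 1)^2 + (w $ 2)^2) * u $ 1"

lemma relative_energy_add: "relative_energy w (u + v) = relative_energy w u + relative_energy w v"
  by (simp add: relative_energy_def algebra_simps add_divide_distrib)

lemma relative_energy_scaleR: "relative_energy w (c *\<^sub>R u) = c * relative_energy w u"
  by (simp add: relative_energy_def algebra_simps)

lemma power2_norm_vec2: "(norm (x :: real^2))^2 = (x $ 1)^2 + (x $ 2)^2"
  unfolding power2_norm_eq_inner by (simp add: inner_vec_def sum_2 power2_eq_square)

lemma relative_energy_eq:
  assumes "density u \<noteq> 0"
  shows "relative_energy w u = internal_energy_density u + 1/2 * density u * (norm (w - velocity u))^2"
  using assms
  unfolding power2_norm_vec2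
  by (simp add: relative_energy_def internal_energy_density_def density_def velocity_def
      field_simps power2_eq_square)

text \<open>
  The frame moving with the fluid attains the minimum of the relative energy, which is the internal energy.
  The right-hand side consists of linear inequalities in \<open>u\<close>, so that the cone properties below follow from
  linearity alone, without the quotient in the definition of the internal energy.
\<close>

lemma admissible_iff_relative_energy:
  "u \<in> admissible \<longleftrightarrow> density u > 0 \<and> (\<forall>w. relative_energy w u > 0)"
proof
  assume "u \<in> admissible"
  then show "density u > 0 \<and> (\<forall>w. relative_energy w u > 0)"
    by (auto simp: admissible_def relative_energy_eq intro!: add_pos_nonneg)
next
  assume *: "density u > 0 \<and> (\<forall>w. relative_energy w u > 0)"
  then have "relative_energy (velocity u) u > 0" by blast
  with * show "u \<in> admissible" by (simp add: admissible_def relative_energy_eq)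
qed

lemma admissible_add: "u \<in> admissible \<Longrightarrow> v \<in> admissible \<Longrightarrow> u + v \<in> admissible"
  unfolding admissible_iff_relative_energy
  by (auto simp: relative_energy_add density_def intro: add_pos_pos)

lemma admissible_scaleR: "c > 0 \<Longrightarrow> u \<in> admissible \<Longrightarrow> c *\<^sub>R u \<in> admissible"
  unfolding admissible_iff_relative_energy by (auto simp: relative_energy_scaleR density_def)

lemma admissible_scaleR_iff: "c > 0 \<Longrightarrow> c *\<^sub>R u \<in> admissible \<longleftrightarrow> u \<in> admissible"
  using admissible_scaleR[of c u] admissible_scaleR[of "inverse c" "c *\<^sub>R u"] by auto

lemma admissible_add_sum:
  assumes "u \<in> admissible" and "\<And>x. x \<in> S \<Longrightarrow> f x \<in> admissible"
  shows "u + sum f S \<in> admissible"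
  using assms(2)
proof (induction S rule: infinite_finite_induct)
  case (insert x S)
  then have "f x + (u + sum f S) \<in> admissible" by (intro admissible_add[of "f x"]) auto
  with insert show ?case by (simp add: ac_simps)
qed (use assms(1) in auto)


section \<open>The wave speed bound\<close>

text \<open>
  Linear in \<open>n\<close>, which need not be a unit vector: this absorbs the lengths of the graph normals and the face
  weights.
\<close>

definition normal_flux :: "real \<Rightarrow> real^2 \<Rightarrow> state \<Rightarrow> viscous_flux \<Rightarrow> state" where
  "normal_flux \<gamma> n u \<sigma> = (\<Sum>k\<in>UNIV. n $ k *\<^sub>R (inviscid_flux \<gamma> u $ k - \<sigma> $ k))"

lemma vector_4:
  fixes w x y z :: "'a::zero"
  shows "(vector [w, x, y, z] :: 'a^4) $ 1 = w" "(vector [w, x, y, z] :: 'a^4) $ 2 = x"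
    "(vector [w, x, y, z] :: 'a^4) $ 3 = y" "(vector [w, x, y, z] :: 'a^4) $ 4 = z"
  unfolding vector_def by simp_all

lemma normal_flux_zero [simp]: "normal_flux \<gamma> 0 u \<sigma> = 0"
  by (simp add: normal_flux_def)

lemma normal_flux_minus [simp]: "normal_flux \<gamma> (- n) u \<sigma> = - normal_flux \<gamma> n u \<sigma>"
  by (simp add: normal_flux_def sum_negf)

lemma normal_flux_add: "normal_flux \<gamma> (n + m) u \<sigma> = normal_flux \<gamma> n u \<sigma> + normal_flux \<gamma> m u \<sigma>"
  by (simp add: normal_flux_def scaleR_left_distrib sum.distrib)

lemma normal_flux_scaleR: "normal_flux \<gamma> (c *\<^sub>R n) u \<sigma> = c *\<^sub>R normal_flux \<gamma> n u \<sigma>"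
  by (simp add: normal_flux_def scaleR_sum_right)

lemma normal_flux_sum: "normal_flux \<gamma> (sum n S) u \<sigma> = (\<Sum>x\<in>S. normal_flux \<gamma> (n x) u \<sigma>)"
  by (induction S rule: infinite_finite_induct) (auto simp: normal_flux_add)

text \<open>
  The viscosities of a pair of nodes are computed from opposite normals on the two sides; they agree because
  \<open>\<beta>\<close> is even.
\<close>

lemma beta_minus [simp]: "beta \<gamma> \<epsilon>\<^sub>0 u \<sigma> (- n) = beta \<gamma> \<epsilon>\<^sub>0 u \<sigma> n"
proof -
  have "normal_stress \<sigma> (- n) - pressure \<gamma> u *\<^sub>R (- n)
      = - (normal_stress \<sigma> n - pressure \<gamma> u *\<^sub>R n)"
    by (simp add: Finite_Cartesian_Product.vec_eq_iff forall_2 normal_stress_def)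
  then have "norm (normal_stress \<sigma> (- n) - pressure \<gamma> u *\<^sub>R (- n))
      = norm (normal_stress \<sigma> n - pressure \<gamma> u *\<^sub>R n)"
    by (metis norm_minus_cancel)
  then have "beta_radicand \<gamma> u \<sigma> (- n) = beta_radicand \<gamma> u \<sigma> n"
    unfolding beta_radicand_def by simp
  then show ?thesis unfolding beta_def by simp
qed

lemma beta_pos:
  assumes "u \<in> admissible" "\<epsilon>\<^sub>0 > 0"
  shows "beta \<gamma> \<epsilon>\<^sub>0 u \<sigma> n > 0"
proof -
  have "density u > 0" "specific_internal_energy u > 0"
    using assms by (auto simp: admissible_def specific_internal_energy_def)
  then have "beta_radicand \<gamma> u \<sigma> n \<ge> 0"
    unfolding beta_radicand_def by simp
  with \<open>density u > 0\<close> \<open>specific_internal_energy u > 0\<close>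
  have "1 / (2 * (density u)^2 * specific_internal_energy u) *
       (sqrt (beta_radicand \<gamma> u \<sigma> n) + density u * \<bar>heat_flux u \<sigma> \<bullet> n\<bar>) \<ge> 0"
    by simp
  then show ?thesis using assms(2) unfolding beta_def by linarith
qed

text \<open>
  Replacing \<open>b\<close> by its absolute value in the larger root gives a bound that serves both orientations of the
  normal.
\<close>

lemma quadratic_pos_beyond_root:
  fixes a b c x :: real
  assumes "a > 0" "c \<ge> 0" "x > (sqrt (b^2 + 4 * a * c) + \<bar>b\<bar>) / (2 * a)"
  shows "a * x^2 - b * x - c > 0"
proof -
  define d where "d = sqrt (b^2 + 4 * a * c)"
  have d: "d \<ge> 0" "d^2 = b^2 + 4 * a * c" using assms by (auto simp: d_def)
  have "2 * a * x > d + \<bar>b\<bar>" using assms by (simp add: d_def field_simps)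
  then have "2 * a * x - b > d" by linarith
  then have "(2 * a * x - b)^2 > d^2" using d(1) by (intro power_strict_mono) auto
  then have "4 * a * (a * x^2 - b * x - c) > 0"
    unfolding d(2) by (simp add: power2_eq_square algebra_simps)
  then show ?thesis using assms(1) by (simp add: zero_less_mult_iff)
qed

lemma internal_energy_eq:
  "internal_energy_density u = u $ 4 - ((u $ 2)^2 + (u $ 3)^2) / (2 * u $ 1)"
  by (cases "u $ 1 = 0")
    (auto simp: internal_energy_density_def density_def velocity_def field_simps power2_eq_square)

text \<open>
  With \<open>x = s - n \<cdot> U\<close>, \<open>a = n \<cdot> \<tau> - p n\<close> and \<open>q\<close> the normal heat flux, the new state has density
  \<open>\<rho> x\<close>, momentum \<open>\<rho> x U + a\<close> and energy \<open>E x + U \<cdot> a - q\<close>. The terms containing \<open>U\<close> drop out of its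
  internal energy, which is \<open>(\<rho>e x\<^sup>2 - q x - |a|\<^sup>2 / (2\<rho>)) / x\<close>. The symmetry of the stress enters
  in the momentum: the flux carries the columns of the stress, \<open>n \<cdot> \<tau>\<close> its rows.
\<close>

lemma admissible_scaleR_minus_normal_flux:
  assumes u: "u \<in> admissible" and vs: "viscous_structure \<sigma>" and "\<epsilon>\<^sub>0 > 0"
    and s: "s \<ge> beta \<gamma> \<epsilon>\<^sub>0 u \<sigma> n"
  shows "s *\<^sub>R u - normal_flux \<gamma> n u \<sigma> \<in> admissible"
proof -
  define \<rho> where "\<rho> = density u"
  define ie where "ie = internal_energy_density u"
  define U where "U = velocity u"
  define v where "v = n \<bullet> U"
  define a where "a = normal_stress \<sigma> n - pressure \<gamma> u *\<^sub>R n"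
  define q where "q = heat_flux u \<sigma> \<bullet> n"
  define x where "x = s - v"
  define u' where "u' = s *\<^sub>R u - normal_flux \<gamma> n u \<sigma>"
  have \<rho>: "\<rho> > 0" and ie: "ie > 0" using u by (auto simp: admissible_def \<rho>_def ie_def)
  have rad: "beta_radicand \<gamma> u \<sigma> n = \<rho>^2 * (q^2 + 4 * ie * ((norm a)^2 / (2 * \<rho>)))"
    using \<rho> by (simp add: beta_radicand_def specific_internal_energy_def
        q_def[symmetric] a_def[symmetric] \<rho>_def[symmetric] ie_def[symmetric] field_simps power2_eq_square)
  have "beta \<gamma> \<epsilon>\<^sub>0 u \<sigma> n = \<epsilon>\<^sub>0 + \<bar>v\<bar> + (sqrt (q^2 + 4 * ie * ((norm a)^2 / (2 * \<rho>))) + \<bar>q\<bar>) / (2 * ie)"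
    using \<rho> ie unfolding beta_def rad real_sqrt_mult specific_internal_energy_def
      q_def[symmetric] \<rho>_def[symmetric] ie_def[symmetric] U_def[symmetric] v_def[symmetric]
    by (simp add: add_divide_distrib power2_eq_square)
  then have x: "x > (sqrt (q^2 + 4 * ie * ((norm a)^2 / (2 * \<rho>))) + \<bar>q\<bar>) / (2 * ie)"
    using s \<open>\<epsilon>\<^sub>0 > 0\<close> unfolding x_def by linarith
  moreover have "(sqrt (q^2 + 4 * ie * ((norm a)^2 / (2 * \<rho>))) + \<bar>q\<bar>) / (2 * ie) \<ge> 0"
    using \<rho> ie by simp
  ultimately have "x > 0" by linarith
  \<comment> \<open>The last summand of \<open>\<beta>\<close> bounds the roots of this polynomial; \<open>\<epsilon>\<^sub>0\<close> makes the inequality strict, and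
      \<open>|v|\<close> compensates the shift from \<open>s\<close> to \<open>x\<close>.\<close>
  have quad: "ie * x^2 - q * x - (norm a)^2 / (2 * \<rho>) > 0"
    using \<rho> ie x by (intro quadratic_pos_beyond_root) auto
  have U: "u $ 1 = \<rho>" "u $ 2 = \<rho> * U $ 1" "u $ 3 = \<rho> * U $ 2"
    "u $ 4 = ie + 1/2 * \<rho> * ((U $ 1)^2 + (U $ 2)^2)"
    using \<rho> by (auto simp: \<rho>_def U_def ie_def density_def velocity_def internal_energy_density_def)
  have v: "v = n $ 1 * U $ 1 + n $ 2 * U $ 2"
    by (simp add: v_def inner_vec_def sum_2)
  have u1: "u' $ 1 = \<rho> * x"
    using vs by (simp add: u'_def normal_flux_def sum_2 inviscid_flux_def Let_def vector_4 x_def v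
        viscous_structure_def U_def[symmetric] \<rho>_def[symmetric] U algebra_simps)
  have u2: "u' $ 2 = \<rho> * x * U $ 1 + a $ 1"
    using vs by (simp add: u'_def normal_flux_def sum_2 inviscid_flux_def Let_def vector_4 x_def v a_def
        viscous_structure_def normal_stress_def U_def[symmetric] \<rho>_def[symmetric] U
        algebra_simps power2_eq_square)
  have u3: "u' $ 3 = \<rho> * x * U $ 2 + a $ 2"
    using vs by (simp add: u'_def normal_flux_def sum_2 inviscid_flux_def Let_def vector_4 x_def v a_def
        viscous_structure_def normal_stress_def U_def[symmetric] \<rho>_def[symmetric] U
        algebra_simps power2_eq_square)
  have u4: "u' $ 4 = (ie + 1/2 * \<rho> * ((U $ 1)^2 + (U $ 2)^2)) * x + U $ 1 * a $ 1 + U $ 2 * a $ 2 - q"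
    using vs by (simp add: u'_def normal_flux_def sum_2 inviscid_flux_def Let_def vector_4 x_def v a_def q_def
        heat_flux_def inner_vec_def
        viscous_structure_def normal_stress_def U_def[symmetric] \<rho>_def[symmetric] U
        algebra_simps power2_eq_square)
  have "internal_energy_density u' = (ie * x^2 - q * x - (norm a)^2 / (2 * \<rho>)) / x"
    using \<rho> \<open>x > 0\<close> unfolding internal_energy_eq u1 u2 u3 u4 power2_norm_vec2
    by (simp add: field_simps power2_eq_square)
  with quad \<open>x > 0\<close> have "internal_energy_density u' > 0" by simp
  then show ?thesis
    using \<rho> \<open>x > 0\<close> u1 unfolding u'_def[symmetric] by (simp add: admissible_def density_def)
qed

text \<open>
  The form in which the bound meets the scheme, where \<open>\<beta>\<close> is evaluated at the normalized vector and multiplied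
  by its length.
\<close>

lemma admissible_scaleR_minus_normal_flux_scaled:
  assumes "u \<in> admissible" "viscous_structure \<sigma>" "\<epsilon>\<^sub>0 > 0" and n: "n \<noteq> 0"
    and l: "l \<ge> beta \<gamma> \<epsilon>\<^sub>0 u \<sigma> (n /\<^sub>R norm n) * norm n"
  shows "l *\<^sub>R u - normal_flux \<gamma> n u \<sigma> \<in> admissible"
proof -
  have "(l / norm n) *\<^sub>R u - normal_flux \<gamma> (n /\<^sub>R norm n) u \<sigma> \<in> admissible"
    using assms by (intro admissible_scaleR_minus_normal_flux) (auto simp: field_simps)
  then have "norm n *\<^sub>R ((l / norm n) *\<^sub>R u - normal_flux \<gamma> (n /\<^sub>R norm n) u \<sigma>) \<in> admissible"
    using n by (intro admissible_scaleR) auto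
  then show ?thesis
    using n by (simp add: algebra_simps normal_flux_scaleR)
qed


section \<open>The scheme at a node\<close>

lemma graph_normal_swap:
  assumes "periodic_mesh D" "i < nvol D e" "j < nvol D e"
  shows "graph_normal D e j i = - graph_normal D e i j"
proof -
  have Q: "QL D e k \<in> carrier_mat (nvol D e) (nvol D e)" for k
    using assms(1) by (simp add: periodic_mesh_def sbp_element_def)
  have "skew_Q D e k $$ (j, i) = - skew_Q D e k $$ (i, j)" for k
    using Q[of k] assms(2,3) by (simp add: skew_Q_def)
  then show ?thesis by (simp add: graph_normal_def Finite_Cartesian_Product.vec_eq_iff)
qed

lemma graph_viscosity_swap:
  assumes "periodic_mesh D" "i < nvol D e" "j < nvol D e"
  shows "graph_viscosity D \<gamma> \<epsilon>\<^sub>0 u \<sigma> e j i = graph_viscosity D \<gamma> \<epsilon>\<^sub>0 u \<sigma> e i j"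
  using graph_normal_swap[OF assms]
  by (auto simp: graph_viscosity_def Let_def max.commute)

text \<open>
  Since \<open>Q 1 = 0\<close>, the row sums of \<open>Q - Q\<^sup>T\<close> are those of \<open>- (Q + Q\<^sup>T) = - E\<^sup>T B E\<close>. That matrix is diagonal, its
  entry at \<open>i\<close> collecting all face points located at the node \<open>i\<close>.
\<close>

lemma sum_graph_normal:
  assumes "periodic_mesh D" and i: "i < nvol D e"
  shows "(\<Sum>j<nvol D e. graph_normal D e i j)
    = - (\<Sum>j\<in>exterior_neighbors D e i. (fweight D e j / 2) *\<^sub>R fnormal D e j)"
proof -
  let ?N = "nvol D e" and ?F = "nface D e"
  have "(\<Sum>j<?N. graph_normal D e i j $ k)
      = - (\<Sum>f\<in>exterior_neighbors D e i. fweight D e f / 2 * fnormal D e f $ k)" for k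
  proof -
    let ?Q = "QL D e k" and ?E = "E_mat D e" and ?B = "B_mat D e k"
    have Q: "?Q \<in> carrier_mat ?N ?N" and sbp: "?Q + transpose_mat ?Q = transpose_mat ?E * ?B * ?E"
      and one: "?Q *\<^sub>v Matrix.vec ?N (\<lambda>_. 1) = 0\<^sub>v ?N"
      using assms(1) by (auto simp: periodic_mesh_def sbp_element_def)
    have "(\<Sum>j<?N. ?Q $$ (i, j)) = Matrix.vec_index (?Q *\<^sub>v Matrix.vec ?N (\<lambda>_. 1)) i"
      using Q i by (simp add: scalar_prod_def lessThan_atLeast0)
    then have row: "(\<Sum>j<?N. ?Q $$ (i, j)) = 0" using one i by simp
    have EBE: "(transpose_mat ?E * ?B * ?E) $$ (i, j) =
        (\<Sum>f<?F. if fnode D e f = i \<and> fnode D e f = j then fweight D e f * fnormal D e f $ k else 0)"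
      if "j < ?N" for j
    proof -
      have "transpose_mat ?E * ?B * ?E = transpose_mat ?E * (?B * ?E)"
        by (rule assoc_mult_mat[of _ ?N ?F _ ?F _ ?N]) (auto simp: E_mat_def B_mat_def)
      also have "?B * ?E = Matrix.mat ?F ?N (\<lambda>(f, j). fweight D e f * fnormal D e f $ k * ?E $$ (f, j))"
        unfolding B_mat_def by (rule mat_diag_mult_left) (auto simp: E_mat_def)
      finally show ?thesis using i that
        by (auto simp: E_mat_def scalar_prod_def lessThan_atLeast0 intro!: sum.cong)
    qed
    have "(\<Sum>j<?N. ?Q $$ (i, j) + ?Q $$ (j, i)) = (\<Sum>j<?N. (transpose_mat ?E * ?B * ?E) $$ (i, j))"
      using Q i by (auto simp: sbp[symmetric] intro!: sum.cong)
    also have "\<dots> = (\<Sum>f<?F. \<Sum>j<?N.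
        if fnode D e f = i \<and> fnode D e f = j then fweight D e f * fnormal D e f $ k else 0)"
      by (subst sum.swap) (simp add: EBE)
    also have "\<dots> = (\<Sum>f<?F. if fnode D e f = i then fweight D e f * fnormal D e f $ k else 0)"
      using i by (intro sum.cong) auto
    also have "\<dots> = (\<Sum>f\<in>exterior_neighbors D e i. fweight D e f * fnormal D e f $ k)"
      by (simp add: exterior_neighbors_def sum.If_cases lessThan_def Collect_conj_eq)
    finally have sym: "(\<Sum>j<?N. ?Q $$ (i, j)) + (\<Sum>j<?N. ?Q $$ (j, i))
        = (\<Sum>f\<in>exterior_neighbors D e i. fweight D e f * fnormal D e f $ k)"
      by (simp add: sum.distrib)
    have "(\<Sum>j<?N. graph_normal D e i j $ k) = (\<Sum>j<?N. (?Q $$ (i, j) - ?Q $$ (j, i)) / 2)"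
      using Q i by (auto simp: graph_normal_def skew_Q_def intro!: sum.cong)
    also have "\<dots> = ((\<Sum>j<?N. ?Q $$ (i, j)) - (\<Sum>j<?N. ?Q $$ (j, i))) / 2"
      by (simp add: sum_subtractf flip: sum_divide_distrib)
    also have "\<dots> = - (\<Sum>f\<in>exterior_neighbors D e i. fweight D e f * fnormal D e f $ k) / 2"
      using row sym by simp
    finally show ?thesis by (simp add: sum_divide_distrib)
  qed
  then show ?thesis
    by (simp add: Finite_Cartesian_Product.vec_eq_iff sum_component)
qed

text \<open>
  The factor 1/2 of the averaged interface flux is moved into the normal, in agreement with the factor 1/2 in
  the definition of the graph normals.
\<close>

definition face_normal_flux ::
  "'e dg_mesh \<Rightarrow> real \<Rightarrow> ('e \<Rightarrow> nat \<Rightarrow> state) \<Rightarrow> ('e \<Rightarrow> nat \<Rightarrow> viscous_flux) \<Rightarrow> 'e \<Rightarrow> nat \<Rightarrow> state" where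
  "face_normal_flux D \<gamma> u \<sigma> e j =
     normal_flux \<gamma> ((fweight D e j / 2) *\<^sub>R fnormal D e j) (face_value D u e j) (face_value D \<sigma> e j)"

definition face_normal_flux_plus ::
  "'e dg_mesh \<Rightarrow> real \<Rightarrow> ('e \<Rightarrow> nat \<Rightarrow> state) \<Rightarrow> ('e \<Rightarrow> nat \<Rightarrow> viscous_flux) \<Rightarrow> 'e \<Rightarrow> nat \<Rightarrow> state" where
  "face_normal_flux_plus D \<gamma> u \<sigma> e j =
     normal_flux \<gamma> ((fweight D e j / 2) *\<^sub>R fnormal D e j)
       (face_value_plus D u e j) (face_value_plus D \<sigma> e j)"

text \<open>
  What node \<open>i\<close> loses to node \<open>j\<close> of the same element per unit time.
\<close>

definition volume_exchange ::
  "'e dg_mesh \<Rightarrow> real \<Rightarrow> real \<Rightarrow> ('e \<Rightarrow> nat \<Rightarrow> state) \<Rightarrow> ('e \<Rightarrow> nat \<Rightarrow> viscous_flux) \<Rightarrow>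
     'e \<Rightarrow> nat \<Rightarrow> nat \<Rightarrow> state" where
  "volume_exchange D \<gamma> \<epsilon>\<^sub>0 u \<sigma> e i j =
     normal_flux \<gamma> (graph_normal D e i j) (u e i) (\<sigma> e i)
     + normal_flux \<gamma> (graph_normal D e i j) (u e j) (\<sigma> e j)
     - graph_viscosity D \<gamma> \<epsilon>\<^sub>0 u \<sigma> e i j *\<^sub>R (u e j - u e i)"

text \<open>
  What the element \<open>e\<close> loses through its face point \<open>j\<close> per unit time. The viscosity is summed over \<open>k\<close>, because
  the jump does not depend on \<open>k\<close>.
\<close>

definition face_exchange ::
  "'e dg_mesh \<Rightarrow> real \<Rightarrow> real \<Rightarrow> ('e \<Rightarrow> nat \<Rightarrow> state) \<Rightarrow> ('e \<Rightarrow> nat \<Rightarrow> viscous_flux) \<Rightarrow>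
     'e \<Rightarrow> nat \<Rightarrow> state" where
  "face_exchange D \<gamma> \<epsilon>\<^sub>0 u \<sigma> e j =
     face_normal_flux D \<gamma> u \<sigma> e j + face_normal_flux_plus D \<gamma> u \<sigma> e j
     - (\<Sum>k\<in>UNIV. face_viscosity D \<gamma> \<epsilon>\<^sub>0 u \<sigma> e k j) *\<^sub>R jump D u e j"

lemma mat_apply_diag: "j < n \<Longrightarrow> mat_apply (mat_diag n d) v j = d j *\<^sub>R v j"
proof -
  assume "j < n"
  then have "mat_apply (mat_diag n d) v j = (\<Sum>l<n. if l = j then d j *\<^sub>R v j else 0)"
    unfolding mat_apply_def by (intro sum.cong) (auto simp: mat_diag_def)
  with \<open>j < n\<close> show ?thesis by simp
qed

lemma mat_apply_transpose_E_mat: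
  assumes "i < nvol D e"
  shows "mat_apply (transpose_mat (E_mat D e)) v i = (\<Sum>j\<in>exterior_neighbors D e i. v j)"
proof -
  have "mat_apply (transpose_mat (E_mat D e)) v i
      = (\<Sum>j<nface D e. if fnode D e j = i then v j else 0)"
    using assms by (auto simp: mat_apply_def E_mat_def intro!: sum.cong)
  then show ?thesis
    by (simp add: exterior_neighbors_def sum.If_cases lessThan_def Collect_conj_eq)
qed

lemma volume_terms_eq:
  assumes "periodic_mesh D" and i: "i < nvol D e"
  shows "(\<Sum>k\<in>UNIV. hadamard_one (skew_Q D e k) (volume_flux \<gamma> u \<sigma> e k) i)
      - hadamard_one (Lambda_mat D \<gamma> \<epsilon>\<^sub>0 u \<sigma> e) (\<lambda>i j. u e j - u e i) i
    = (\<Sum>j<nvol D e. volume_exchange D \<gamma> \<epsilon>\<^sub>0 u \<sigma> e i j)"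
proof -
  have dim: "dim_col (skew_Q D e k) = nvol D e" for k
    using assms(1) by (auto simp: skew_Q_def periodic_mesh_def sbp_element_def)
  have *: "(\<Sum>k\<in>UNIV. skew_Q D e k $$ (i, j) *\<^sub>R volume_flux \<gamma> u \<sigma> e k i j)
      = normal_flux \<gamma> (graph_normal D e i j) (u e i) (\<sigma> e i)
      + normal_flux \<gamma> (graph_normal D e i j) (u e j) (\<sigma> e j)" for j
    unfolding normal_flux_def sum.distrib[symmetric]
    by (intro sum.cong) (auto simp: graph_normal_def volume_flux_def algebra_simps)
  have "(\<Sum>k\<in>UNIV. hadamard_one (skew_Q D e k) (volume_flux \<gamma> u \<sigma> e k) i)
    = (\<Sum>j<nvol D e. \<Sum>k\<in>UNIV. skew_Q D e k $$ (i, j) *\<^sub>R volume_flux \<gamma> u \<sigma> e k i j)"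
    unfolding hadamard_one_def dim by (rule sum.swap)
  then show ?thesis
    using i by (simp add: * hadamard_one_def Lambda_mat_def volume_exchange_def sum_subtractf)
qed

lemma face_terms_eq:
  assumes "i < nvol D e"
  shows "(\<Sum>k\<in>UNIV. mat_apply (transpose_mat (E_mat D e))
             (\<lambda>j. mat_apply (B_mat D e k) (interface_flux D \<gamma> u \<sigma> e k) j
                - mat_apply (lambda_mat D \<gamma> \<epsilon>\<^sub>0 u \<sigma> e k) (jump D u e) j) i)
    = (\<Sum>j\<in>exterior_neighbors D e i. face_exchange D \<gamma> \<epsilon>\<^sub>0 u \<sigma> e j)"
proof -
  have "(\<Sum>k\<in>UNIV. mat_apply (B_mat D e k) (interface_flux D \<gamma> u \<sigma> e k) j
      - mat_apply (lambda_mat D \<gamma> \<epsilon>\<^sub>0 u \<sigma> e k) (jump D u e) j)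
    = face_exchange D \<gamma> \<epsilon>\<^sub>0 u \<sigma> e j" if "j \<in> exterior_neighbors D e i" for j
  proof -
    have j: "j < nface D e" using that by (simp add: exterior_neighbors_def)
    show ?thesis
      unfolding face_exchange_def face_normal_flux_def face_normal_flux_plus_def normal_flux_def
        sum.distrib[symmetric] scaleR_sum_left sum_subtractf[symmetric]
      using j by (intro sum.cong)
        (auto simp: B_mat_def lambda_mat_def mat_apply_diag interface_flux_def algebra_simps)
  qed
  then show ?thesis
    unfolding mat_apply_transpose_E_mat[OF assms] by (subst sum.swap) (rule sum.cong, auto)
qed

text \<open>
  The matrix form of the scheme, read at a single node as a balance of exchanged quantities.
\<close>

lemma low_order_step_at_node:
  assumes "periodic_mesh D" "\<tau> > 0" "low_order_step D \<gamma> \<epsilon>\<^sub>0 \<tau> \<sigma> u u'" and i: "i < nvol D e"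
  shows "mass D e i *\<^sub>R u' e i = mass D e i *\<^sub>R u e i
    - \<tau> *\<^sub>R ((\<Sum>j<nvol D e. volume_exchange D \<gamma> \<epsilon>\<^sub>0 u \<sigma> e i j)
            + (\<Sum>j\<in>exterior_neighbors D e i. face_exchange D \<gamma> \<epsilon>\<^sub>0 u \<sigma> e j))"
    (is "_ = _ - \<tau> *\<^sub>R ?R")
proof -
  have "mat_apply (M_mat D e) (\<lambda>i. (u' e i - u e i) /\<^sub>R \<tau>) i + ?R = 0"
    using assms(3) i unfolding low_order_step_def
    by (simp add: volume_terms_eq[OF assms(1) i, symmetric] face_terms_eq[OF i, symmetric] add_ac
        add_diff_eq diff_add_eq)
  then have "mass D e i *\<^sub>R ((u' e i - u e i) /\<^sub>R \<tau>) = - ?R"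
    using i by (simp add: M_mat_def mat_apply_diag add_eq_0_iff2)
  then have "\<tau> *\<^sub>R (mass D e i *\<^sub>R ((u' e i - u e i) /\<^sub>R \<tau>)) = - (\<tau> *\<^sub>R ?R)"
    by (simp only: scaleR_minus_right)
  moreover have "\<tau> *\<^sub>R (mass D e i *\<^sub>R ((u' e i - u e i) /\<^sub>R \<tau>)) = mass D e i *\<^sub>R u' e i - mass D e i *\<^sub>R u e i"
    using \<open>\<tau> > 0\<close> by (simp add: scaleR_diff_right field_simps)
  ultimately have "mass D e i *\<^sub>R u' e i - mass D e i *\<^sub>R u e i = - (\<tau> *\<^sub>R ?R)"
    by (simp only:)
  then show ?thesis by (simp add: algebra_simps)
qed


section \<open>Conservation\<close>

lemma sum_antisymmetric_eq_0:
  fixes g :: "'a \<Rightarrow> 'a \<Rightarrow> 'b::real_vector"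
  assumes "\<And>i j. i \<in> A \<Longrightarrow> j \<in> A \<Longrightarrow> g j i = - g i j"
  shows "(\<Sum>i\<in>A. \<Sum>j\<in>A. g i j) = 0"
proof -
  have "(\<Sum>i\<in>A. \<Sum>j\<in>A. g i j) = (\<Sum>i\<in>A. \<Sum>j\<in>A. g j i)" by (rule sum.swap)
  also have "\<dots> = (\<Sum>i\<in>A. \<Sum>j\<in>A. - g i j)" by (intro sum.cong refl assms)
  finally have "(\<Sum>i\<in>A. \<Sum>j\<in>A. g i j) = - (\<Sum>i\<in>A. \<Sum>j\<in>A. g i j)" by (simp add: sum_negf)
  then show ?thesis by (metis eq_neg_iff_add_eq_0 scaleR_2 scaleR_eq_0_iff zero_neq_numeral)
qed

lemma sum_involution_eq_0:
  fixes h :: "'a \<Rightarrow> 'b::real_vector"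
  assumes "\<And>x. x \<in> A \<Longrightarrow> f x \<in> A" "\<And>x. x \<in> A \<Longrightarrow> f (f x) = x" "\<And>x. x \<in> A \<Longrightarrow> h (f x) = - h x"
  shows "sum h A = 0"
proof -
  have "sum h A = (\<Sum>x\<in>A. - h x)"
    by (rule sum.reindex_bij_witness[of A f f]) (use assms in auto)
  then have "sum h A = - sum h A" by (simp add: sum_negf)
  then show ?thesis by (metis eq_neg_iff_add_eq_0 scaleR_2 scaleR_eq_0_iff zero_neq_numeral)
qed

lemma nbr_face_point:
  assumes "periodic_mesh D" "x \<in> face_points D"
  shows "nbr D x \<in> face_points D" and "nbr D (nbr D x) = x"
    and "fweight D (fst (nbr D x)) (snd (nbr D x)) = fweight D (fst x) (snd x)"
    and "fnormal D (fst (nbr D x)) (snd (nbr D x)) = - fnormal D (fst x) (snd x)"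
  using assms unfolding periodic_mesh_def periodic_pairing_def by blast+

lemma face_exchange_nbr:
  assumes "periodic_mesh D" "j < nface D e" and nb: "nbr D (e, j) = (e', j')"
  shows "face_exchange D \<gamma> \<epsilon>\<^sub>0 u \<sigma> e' j' = - face_exchange D \<gamma> \<epsilon>\<^sub>0 u \<sigma> e j"
proof -
  have x: "(e, j) \<in> face_points D" using assms(2) by (simp add: face_points_def)
  have p: "nbr D (e', j') = (e, j)" "fweight D e' j' = fweight D e j"
    "fnormal D e' j' = - fnormal D e j" "j' < nface D e'"
    using nbr_face_point[OF assms(1) x] unfolding nb by (simp_all add: face_points_def)
  have "face_viscosity D \<gamma> \<epsilon>\<^sub>0 u \<sigma> e' k j' = face_viscosity D \<gamma> \<epsilon>\<^sub>0 u \<sigma> e k j" for k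
    using p assms(2) by (simp add: face_viscosity_def B_mat_def mat_diag_def
        face_value_plus_def nb max.commute)
  then show ?thesis
    using p nb by (simp add: face_exchange_def face_normal_flux_def face_normal_flux_plus_def
        face_value_plus_def jump_def scaleR_diff_right)
qed

lemma low_order_step_conservative:
  fixes D :: "('e::finite) dg_mesh"
  assumes "periodic_mesh D" "\<tau> > 0" "low_order_step D \<gamma> \<epsilon>\<^sub>0 \<tau> \<sigma> u u'"
  shows "total_mass D u' = total_mass D u"
proof -
  let ?V = "volume_exchange D \<gamma> \<epsilon>\<^sub>0 u \<sigma>" and ?H = "face_exchange D \<gamma> \<epsilon>\<^sub>0 u \<sigma>"
  have tm: "total_mass D v = (\<Sum>e\<in>UNIV. \<Sum>i<nvol D e. mass D e i *\<^sub>R v e i)" for v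
    unfolding total_mass_def by (intro sum.cong refl) (simp add: M_mat_def mat_apply_diag)
  have V: "(\<Sum>i<nvol D e. \<Sum>j<nvol D e. ?V e i j) = 0" for e
  proof (rule sum_antisymmetric_eq_0)
    fix i j assume "i \<in> {..<nvol D e}" "j \<in> {..<nvol D e}"
    then have "graph_normal D e j i = - graph_normal D e i j"
      "graph_viscosity D \<gamma> \<epsilon>\<^sub>0 u \<sigma> e j i = graph_viscosity D \<gamma> \<epsilon>\<^sub>0 u \<sigma> e i j"
      using assms(1) by (simp_all only: lessThan_iff graph_normal_swap[of D i e j] graph_viscosity_swap[of D i e j])
    then show "?V e j i = - ?V e i j"
      by (simp add: volume_exchange_def algebra_simps)
  qed
  have "(\<Sum>i<nvol D e. \<Sum>j\<in>exterior_neighbors D e i. ?H e j) = (\<Sum>j<nface D e. ?H e j)" for e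
  proof -
    have "fnode D e ` {..<nface D e} \<subseteq> {..<nvol D e}"
      using assms(1) by (auto simp: periodic_mesh_def sbp_element_def)
    from sum.group[OF _ _ this, of "?H e"] show ?thesis
      by (simp add: exterior_neighbors_def)
  qed
  then have "(\<Sum>e\<in>UNIV. \<Sum>i<nvol D e. \<Sum>j\<in>exterior_neighbors D e i. ?H e j)
      = (\<Sum>e\<in>UNIV. \<Sum>j<nface D e. ?H e j)" by simp
  also have "\<dots> = (\<Sum>(e, j)\<in>face_points D. ?H e j)"
    by (subst sum.Sigma) (auto simp: face_points_def intro!: sum.cong)
  also have "\<dots> = 0"
  proof (rule sum_involution_eq_0[where f = "nbr D"])
    fix x assume x: "x \<in> face_points D"
    then show "nbr D x \<in> face_points D" "nbr D (nbr D x) = x"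
      by (simp_all only: nbr_face_point[OF assms(1)])
    show "(case nbr D x of (e, j) \<Rightarrow> ?H e j) = - (case x of (e, j) \<Rightarrow> ?H e j)"
    proof -
      obtain e j e' j' where e: "x = (e, j)" and e': "nbr D (e, j) = (e', j')" by fastforce
      have "j < nface D e" using x e by (simp add: face_points_def)
      from face_exchange_nbr[OF assms(1) this e'] show ?thesis
        using e e' by (simp only: case_prod_conv)
    qed
  qed
  finally have H: "(\<Sum>e\<in>UNIV. \<Sum>i<nvol D e. \<Sum>j\<in>exterior_neighbors D e i. ?H e j) = 0" .
  have "total_mass D u' = total_mass D u - \<tau> *\<^sub>R ((\<Sum>e\<in>UNIV. \<Sum>i<nvol D e. \<Sum>j<nvol D e. ?V e i j)
      + (\<Sum>e\<in>UNIV. \<Sum>i<nvol D e. \<Sum>j\<in>exterior_neighbors D e i. ?H e j))"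
  proof -
    have "total_mass D u' = (\<Sum>e\<in>UNIV. \<Sum>i<nvol D e. mass D e i *\<^sub>R u e i
        - \<tau> *\<^sub>R ((\<Sum>j<nvol D e. ?V e i j) + (\<Sum>j\<in>exterior_neighbors D e i. ?H e j)))"
      unfolding tm by (intro sum.cong refl low_order_step_at_node[OF assms]) simp
    then show ?thesis
      unfolding tm by (simp only: sum_subtractf sum.distrib scaleR_sum_right scaleR_right_distrib)
  qed
  then show ?thesis by (simp add: V H)
qed


section \<open>Preservation of admissibility\<close>

text \<open>
  Splits the part proportional to a reference state \<open>w\<close> off the viscous terms.
\<close>

lemma sum_scaled_split:
  fixes v g :: "'a \<Rightarrow> 'b::real_vector"
  shows "(\<Sum>j\<in>S. \<tau> *\<^sub>R (l j *\<^sub>R v j - g j))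
    = (\<tau> * sum l S) *\<^sub>R w - \<tau> *\<^sub>R (\<Sum>j\<in>S. g j - l j *\<^sub>R (v j - w))"
  unfolding scaleR_sum_right sum_distrib_left scaleR_sum_left sum_subtractf[symmetric]
  by (intro sum.cong) (auto simp: algebra_simps)

text \<open>
  On the right, the volume and face fluxes at the node's own state cancel by \<open>sum_graph_normal\<close>, and the
  viscous parts \<open>\<lambda> u\<^sub>i\<close> add up to the node viscosity. The terms that are left involve one state each, which
  is what makes the wave speed bound applicable.
\<close>

lemma low_order_step_cone_combination:
  assumes "periodic_mesh D" "\<tau> > 0" "low_order_step D \<gamma> \<epsilon>\<^sub>0 \<tau> \<sigma> u u'" and i: "i < nvol D e"
  shows "mass D e i *\<^sub>R u' e i =
    (mass D e i - \<tau> * node_viscosity D \<gamma> \<epsilon>\<^sub>0 u \<sigma> e i) *\<^sub>R u e i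
    + (\<Sum>j\<in>volume_neighbors D e i. \<tau> *\<^sub>R (graph_viscosity D \<gamma> \<epsilon>\<^sub>0 u \<sigma> e i j *\<^sub>R u e j
         - normal_flux \<gamma> (graph_normal D e i j) (u e j) (\<sigma> e j)))
    + (\<Sum>j\<in>exterior_neighbors D e i. \<tau> *\<^sub>R
         ((\<Sum>k\<in>UNIV. face_viscosity D \<gamma> \<epsilon>\<^sub>0 u \<sigma> e k j) *\<^sub>R face_value_plus D u e j
         - face_normal_flux_plus D \<gamma> u \<sigma> e j))"
proof -
  let ?l = "graph_viscosity D \<gamma> \<epsilon>\<^sub>0 u \<sigma> e i" and ?n = "graph_normal D e i"
  let ?L = "\<lambda>j. \<Sum>k\<in>UNIV. face_viscosity D \<gamma> \<epsilon>\<^sub>0 u \<sigma> e k j"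
  let ?V = "volume_neighbors D e i" and ?X = "exterior_neighbors D e i"
  \<comment> \<open>This is where summation by parts is used.\<close>
  have own: "(\<Sum>j<nvol D e. normal_flux \<gamma> (?n j) (u e i) (\<sigma> e i))
      + (\<Sum>j\<in>?X. face_normal_flux D \<gamma> u \<sigma> e j) = 0"
  proof -
    have "(\<Sum>j\<in>?X. face_normal_flux D \<gamma> u \<sigma> e j)
        = normal_flux \<gamma> (\<Sum>j\<in>?X. (fweight D e j / 2) *\<^sub>R fnormal D e j) (u e i) (\<sigma> e i)"
      unfolding normal_flux_sum
      by (intro sum.cong) (auto simp: face_normal_flux_def face_value_def exterior_neighbors_def)
    then show ?thesis
      by (simp add: sum_graph_normal[OF assms(1) i] flip: normal_flux_sum)
  qed
  have "(\<Sum>j<nvol D e. normal_flux \<gamma> (?n j) (u e j) (\<sigma> e j) - ?l j *\<^sub>R (u e j - u e i))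
      = (\<Sum>j\<in>?V. normal_flux \<gamma> (?n j) (u e j) (\<sigma> e j) - ?l j *\<^sub>R (u e j - u e i))"
    by (rule sum.mono_neutral_right) (auto simp: volume_neighbors_def graph_viscosity_def)
  then have vol: "(\<Sum>j<nvol D e. volume_exchange D \<gamma> \<epsilon>\<^sub>0 u \<sigma> e i j)
      = (\<Sum>j<nvol D e. normal_flux \<gamma> (?n j) (u e i) (\<sigma> e i))
      + (\<Sum>j\<in>?V. normal_flux \<gamma> (?n j) (u e j) (\<sigma> e j) - ?l j *\<^sub>R (u e j - u e i))"
    by (simp add: volume_exchange_def sum.distrib sum_subtractf)
  have "(\<Sum>j\<in>?X. face_exchange D \<gamma> \<epsilon>\<^sub>0 u \<sigma> e j)
      = (\<Sum>j\<in>?X. face_normal_flux D \<gamma> u \<sigma> e j)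
      + (\<Sum>j\<in>?X. face_normal_flux_plus D \<gamma> u \<sigma> e j - ?L j *\<^sub>R (face_value_plus D u e j - u e i))"
    unfolding sum.distrib[symmetric]
    by (intro sum.cong) (auto simp: face_exchange_def jump_def face_value_def exterior_neighbors_def)
  with vol have "(\<Sum>j<nvol D e. volume_exchange D \<gamma> \<epsilon>\<^sub>0 u \<sigma> e i j)
      + (\<Sum>j\<in>?X. face_exchange D \<gamma> \<epsilon>\<^sub>0 u \<sigma> e j)
    = ((\<Sum>j<nvol D e. normal_flux \<gamma> (?n j) (u e i) (\<sigma> e i))
      + (\<Sum>j\<in>?X. face_normal_flux D \<gamma> u \<sigma> e j))
    + ((\<Sum>j\<in>?V. normal_flux \<gamma> (?n j) (u e j) (\<sigma> e j) - ?l j *\<^sub>R (u e j - u e i))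
      + (\<Sum>j\<in>?X. face_normal_flux_plus D \<gamma> u \<sigma> e j - ?L j *\<^sub>R (face_value_plus D u e j - u e i)))"
    by (simp only: add_ac)
  note this[unfolded own add_0_left]
  then have "mass D e i *\<^sub>R u' e i = mass D e i *\<^sub>R u e i - \<tau> *\<^sub>R
      ((\<Sum>j\<in>?V. normal_flux \<gamma> (?n j) (u e j) (\<sigma> e j) - ?l j *\<^sub>R (u e j - u e i))
     + (\<Sum>j\<in>?X. face_normal_flux_plus D \<gamma> u \<sigma> e j - ?L j *\<^sub>R (face_value_plus D u e j - u e i)))"
    by (simp only: low_order_step_at_node[OF assms])
  then show ?thesis
    unfolding sum_scaled_split[where w = "u e i"] node_viscosity_def by (simp add: algebra_simps)
qed

text \<open>
  The face viscosities of the two directions add up to \<open>w/2 (|n\<^sub>1| + |n\<^sub>2|) max \<beta>\<close>, and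
  \<open>|n\<^sub>1| + |n\<^sub>2| \<ge> 1\<close> for a unit normal.
\<close>

lemma face_viscosity_ge:
  assumes "periodic_mesh D" "j < nface D e" "\<epsilon>\<^sub>0 > 0" "face_value_plus D u e j \<in> admissible"
  shows "fweight D e j / 2 *
      beta \<gamma> \<epsilon>\<^sub>0 (face_value_plus D u e j) (face_value_plus D \<sigma> e j) (fnormal D e j)
    \<le> (\<Sum>k\<in>UNIV. face_viscosity D \<gamma> \<epsilon>\<^sub>0 u \<sigma> e k j)"
proof -
  define n where "n = fnormal D e j"
  define w where "w = fweight D e j"
  define b where "b = beta \<gamma> \<epsilon>\<^sub>0 (face_value_plus D u e j) (face_value_plus D \<sigma> e j) n"
  define M where "M = max (beta \<gamma> \<epsilon>\<^sub>0 (face_value D u e j) (face_value D \<sigma> e j) n) b"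
  have w: "w > 0" and n: "norm n = 1"
    using assms(1,2) by (auto simp: periodic_mesh_def sbp_element_def n_def w_def)
  have b: "b > 0" unfolding b_def using assms by (intro beta_pos)
  have "1 * b \<le> (\<Sum>k\<in>UNIV. \<bar>n $ k\<bar>) * M"
    using norm_le_l1_cart[of n] n b by (intro mult_mono) (auto simp: M_def)
  then have "w / 2 * b \<le> w / 2 * ((\<Sum>k\<in>UNIV. \<bar>n $ k\<bar>) * M)"
    using w by (intro mult_left_mono) auto
  also have "\<dots> = (\<Sum>k\<in>UNIV. face_viscosity D \<gamma> \<epsilon>\<^sub>0 u \<sigma> e k j)"
    using assms(2) w unfolding sum_distrib_left sum_distrib_right
    by (intro sum.cong) (auto simp: face_viscosity_def B_mat_def mat_diag_def abs_mult M_def b_def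
        w_def[symmetric] n_def[symmetric])
  finally show ?thesis by (simp add: b_def w_def n_def)
qed

lemma low_order_step_admissible:
  assumes mesh: "periodic_mesh D" and "\<tau> > 0" and "\<epsilon>\<^sub>0 > 0"
    and step: "low_order_step D \<gamma> \<epsilon>\<^sub>0 \<tau> \<sigma> u u'"
    and vs: "\<And>e i. i < nvol D e \<Longrightarrow> viscous_structure (\<sigma> e i)"
    and adm: "\<And>e i. i < nvol D e \<Longrightarrow> u e i \<in> admissible"
    and i: "i < nvol D e" and cfl: "\<tau> * node_viscosity D \<gamma> \<epsilon>\<^sub>0 u \<sigma> e i < mass D e i"
  shows "u' e i \<in> admissible"
proof -
  have m: "mass D e i > 0" using mesh i by (auto simp: periodic_mesh_def sbp_element_def)
  have vol: "\<tau> *\<^sub>R (graph_viscosity D \<gamma> \<epsilon>\<^sub>0 u \<sigma> e i j *\<^sub>R u e j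
         - normal_flux \<gamma> (graph_normal D e i j) (u e j) (\<sigma> e j)) \<in> admissible"
    if "j \<in> volume_neighbors D e i" for j
    using that adm vs \<open>\<tau> > 0\<close> \<open>\<epsilon>\<^sub>0 > 0\<close>
    by (intro admissible_scaleR admissible_scaleR_minus_normal_flux_scaled[where \<epsilon>\<^sub>0 = \<epsilon>\<^sub>0])
      (auto simp: volume_neighbors_def graph_viscosity_def Let_def intro!: mult_right_mono)
  have face: "\<tau> *\<^sub>R ((\<Sum>k\<in>UNIV. face_viscosity D \<gamma> \<epsilon>\<^sub>0 u \<sigma> e k j) *\<^sub>R face_value_plus D u e j
         - face_normal_flux_plus D \<gamma> u \<sigma> e j) \<in> admissible"
    if "j \<in> exterior_neighbors D e i" for j
  proof -
    have j: "j < nface D e" using that by (simp add: exterior_neighbors_def)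
    obtain e' j' where nb: "nbr D (e, j) = (e', j')" by fastforce
    have "(e, j) \<in> face_points D" using j by (simp add: face_points_def)
    from nbr_face_point(1)[OF mesh this] have "nbr D (e, j) \<in> face_points D" .
    then have "j' < nface D e'" using nb by (simp add: face_points_def)
    then have "fnode D e' j' < nvol D e'" using mesh by (auto simp: periodic_mesh_def sbp_element_def)
    then have plus: "face_value_plus D u e j \<in> admissible" "viscous_structure (face_value_plus D \<sigma> e j)"
      using adm vs nb by (auto simp: face_value_plus_def face_value_def)
    have w: "fweight D e j > 0" and n: "norm (fnormal D e j) = 1"
      using mesh j by (auto simp: periodic_mesh_def sbp_element_def)
    then have "fnormal D e j \<noteq> 0" by auto
    then show ?thesis
      unfolding face_normal_flux_plus_def
      using plus w n face_viscosity_ge[OF mesh j \<open>\<epsilon>\<^sub>0 > 0\<close> plus(1), of \<gamma> \<sigma>] \<open>\<tau> > 0\<close> \<open>\<epsilon>\<^sub>0 > 0\<close>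
      by (intro admissible_scaleR admissible_scaleR_minus_normal_flux_scaled[where \<epsilon>\<^sub>0 = \<epsilon>\<^sub>0]) (auto simp: mult.commute)
  qed
  have "mass D e i *\<^sub>R u' e i \<in> admissible"
    unfolding low_order_step_cone_combination[OF mesh \<open>\<tau> > 0\<close> step i]
    by (intro admissible_add_sum vol face admissible_scaleR adm[OF i]) (use cfl in auto)
  then show ?thesis using m by (simp add: admissible_scaleR_iff)
qed

theorem theorem5p2:
  fixes D :: "('e::finite) dg_mesh"
    and \<gamma> \<epsilon>\<^sub>0 \<tau> :: real
    and u u' :: "'e \<Rightarrow> nat \<Rightarrow> state"
    and \<sigma> :: "'e \<Rightarrow> nat \<Rightarrow> viscous_flux"
  assumes "\<gamma> > 1" and "\<epsilon>\<^sub>0 > 0" and "\<tau> > 0"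
    and "periodic_mesh D"
    and "\<And>e i. i < nvol D e \<Longrightarrow> viscous_structure (\<sigma> e i)"
    and "spatial_terms_defined D \<gamma> u \<sigma>"
    and "low_order_step D \<gamma> \<epsilon>\<^sub>0 \<tau> \<sigma> u u'"
  shows "(\<forall>c. total_mass D u' $ c = total_mass D u $ c) \<and>
    ((\<forall>e. \<forall>i < nvol D e. u e i \<in> admissible) \<and>
     (\<forall>e. \<forall>i < nvol D e. 2 * \<tau> * node_viscosity D \<gamma> \<epsilon>\<^sub>0 u \<sigma> e i \<le> mass D e i)
     \<longrightarrow> (\<forall>e. \<forall>i < nvol D e. u' e i \<in> admissible))"
proof (intro conjI impI allI)
  show "total_mass D u' $ c = total_mass D u $ c" for c
    by (simp add: low_order_step_conservative[OF assms(4,3,7)])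
next
  fix e i
  assume *: "(\<forall>e. \<forall>i < nvol D e. u e i \<in> admissible) \<and>
     (\<forall>e. \<forall>i < nvol D e. 2 * \<tau> * node_viscosity D \<gamma> \<epsilon>\<^sub>0 u \<sigma> e i \<le> mass D e i)"
    and i: "i < nvol D e"
  have "mass D e i > 0" using assms(4) i by (auto simp: periodic_mesh_def sbp_element_def)
  moreover have "2 * (\<tau> * node_viscosity D \<gamma> \<epsilon>\<^sub>0 u \<sigma> e i) \<le> mass D e i"
    using * i by (simp add: mult.assoc)
  \<comment> \<open>The old state keeps at least half of the mass, hence a positive coefficient in the cone combination.\<close>
  ultimately have "\<tau> * node_viscosity D \<gamma> \<epsilon>\<^sub>0 u \<sigma> e i < mass D e i" by linarith
  then show "u' e i \<in> admissible"
    using * i assms by (intro low_order_step_admissible[where \<epsilon>\<^sub>0 = \<epsilon>\<^sub>0]) auto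
qed

end
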